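(* Let $\theta=\phi(D)$ be a delta operator with poweroids $x^{\{r\}}$, and let $\eta=\phi^{-1}(D)$. For every formal power series $f$ and every integer $r\ge0$, $$f(D)\,0^{\{r\}}=f(\eta)\,0^r.$$
   Context: Work with polynomials in $x$ (real or complex coefficients); $D=d/dx$. A delta operator is $\theta=\phi(D)$, where $\phi(t)=\sum_{\nu\ge1}k_\nu t^\nu$ is a formal power series with $k_1=1$; $\phi^{-1}$ is its compositional inverse. The poweroids $x^{\{n\}}$, $n=0,1,2,\dots$, of $\theta$ are the unique polynomials with $x^{\{0\}}=1$, $\theta x^{\{n\}}=n\,x^{\{n-1\}}$ for $n\ge1$, and $x^{\{n\}}|_{x=0}=0$ for $n\ge1$. Notation: $f(D)\,0^{\{r\}}=\big(f(D)x^{\{r\}}\big)|_{x=0}$ and $f(\eta)\,0^r=\big(f(\phi^{-1}(D))\,x^r\big)|_{x=0}$. *)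

theory Defs
  imports "HOL-Computational_Algebra.Computational_Algebra"
begin

text \<open>
  \<open>op_series f T p\<close> is \<open>f(T) p = (\<Sum>n. f_n T^n p)\<close> for an operator \<open>T\<close> lowering degrees.
  Stopping at \<open>degree p\<close> omits only zero terms for such \<open>T\<close>: see \<open>funpow_lowers_degree\<close>,
  applicable to \<open>d/dx\<close> by \<open>lowers_degree_pderiv\<close> and to every \<open>\<phi>(d/dx)\<close> with \<open>\<phi>\<close> having no
  constant term by \<open>lowers_degree_op_series\<close>.
\<close>

definition op_series ::
    "'a::comm_semiring_1 fps \<Rightarrow> ('a poly \<Rightarrow> 'a poly) \<Rightarrow> 'a poly \<Rightarrow> 'a poly" where
  "op_series f T p = (\<Sum>n\<le>degree p. smult (fps_nth f n) ((T ^^ n) p))"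

definition delta_series :: "'a::comm_semiring_1 fps \<Rightarrow> bool" where
  "delta_series \<phi> \<longleftrightarrow> fps_nth \<phi> 0 = 0 \<and> fps_nth \<phi> 1 = 1"

definition is_poweroids ::
    "('a::comm_semiring_1 poly \<Rightarrow> 'a poly) \<Rightarrow> (nat \<Rightarrow> 'a poly) \<Rightarrow> bool" where
  "is_poweroids \<theta> p \<longleftrightarrow>
     p 0 = 1 \<and>
     (\<forall>n\<ge>1. \<theta> (p n) = smult (of_nat n) (p (n - 1))) \<and>
     (\<forall>n\<ge>1. poly (p n) 0 = 0)"

text \<open>
  Existence and uniqueness, which give this definite description its meaning, are
  proved for delta operators in \<open>ex1_poweroids\<close> below.
\<close>

definition poweroid ::
    "('a::comm_semiring_1 poly \<Rightarrow> 'a poly) \<Rightarrow> nat \<Rightarrow> 'a poly" where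
  "poweroid \<theta> = (THE p. is_poweroids \<theta> p)"

definition lowers_degree :: "('a::comm_semiring_1 poly \<Rightarrow> 'a poly) \<Rightarrow> bool" where
  "lowers_degree T \<longleftrightarrow> (\<forall>p. T p = 0 \<or> degree (T p) < degree p)"

lemma funpow_lowers_degree:
  assumes "lowers_degree T" and "degree p < n"
  shows "(T ^^ n) p = 0"
proof -
  have T0: "T 0 = 0"
    using assms(1) unfolding lowers_degree_def by (metis degree_0 less_zeroE)
  have "(T ^^ n) p = 0 \<or> degree ((T ^^ n) p) + n \<le> degree p" for n
  proof (induction n)
    case (Suc n)
    show ?case
    proof (cases "(T ^^ n) p = 0")
      case True
      then show ?thesis by (simp add: T0)
    next
      case False
      with Suc have "degree ((T ^^ n) p) + n \<le> degree p" by simp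
      moreover have "T ((T ^^ n) p) = 0 \<or> degree (T ((T ^^ n) p)) < degree ((T ^^ n) p)"
        using assms(1) unfolding lowers_degree_def by blast
      ultimately show ?thesis by auto
    qed
  qed simp
  from this[of n] assms(2) show ?thesis by simp
qed

lemma lowers_degree_pderiv:
  "lowers_degree (pderiv :: 'a::field_char_0 poly \<Rightarrow> 'a poly)"
  unfolding lowers_degree_def by (metis degree_pderiv diff_less pderiv_eq_0_iff neq0_conv zero_less_one)

lemma op_series_atMost:
  assumes "lowers_degree T" and "degree p \<le> N"
  shows "op_series f T p = (\<Sum>n\<le>N. smult (fps_nth f n) ((T ^^ n) p))"
  unfolding op_series_def
proof (rule sum.mono_neutral_left)
  show "\<forall>n\<in>{..N} - {..degree p}. smult (fps_nth f n) ((T ^^ n) p) = 0"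
    using funpow_lowers_degree[OF assms(1)] by auto
qed (use assms in auto)

lemma degree_op_series_pderiv:
  fixes p :: "'a::field_char_0 poly"
  shows "degree (op_series f pderiv p) \<le> degree p"
  unfolding op_series_def
  by (rule degree_sum_le)
     (auto simp: degree_higher_pderiv intro: order_trans[OF degree_smult_le])

lemma lowers_degree_op_series:
  fixes \<phi> :: "'a::field_char_0 fps"
  assumes "fps_nth \<phi> 0 = 0"
  shows "lowers_degree (op_series \<phi> pderiv)"
  unfolding lowers_degree_def
proof
  fix p :: "'a poly"
  show "op_series \<phi> pderiv p = 0 \<or> degree (op_series \<phi> pderiv p) < degree p"
  proof (cases "degree p = 0")
    case True
    then show ?thesis by (simp add: op_series_def assms)
  next
    case False
    have "degree (op_series \<phi> pderiv p) \<le> degree p - 1"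
      unfolding op_series_def
    proof (rule degree_sum_le)
      fix n
      show "degree (smult (fps_nth \<phi> n) ((pderiv ^^ n) p)) \<le> degree p - 1"
        using assms by (cases n) (auto simp: degree_higher_pderiv simp del: funpow.simps)
    qed simp
    with False show ?thesis by linarith
  qed
qed

lemma smult_sum_right: "smult c (sum g A) = (\<Sum>x\<in>A. smult c (g x))"
  by (induction A rule: infinite_finite_induct) (simp_all add: smult_add_right)

lemma op_series_mult:
  fixes p :: "'a::field_char_0 poly"
  shows "op_series (f * g) pderiv p = op_series f pderiv (op_series g pderiv p)"
proof -
  let ?N = "degree p"
  let ?h = "\<lambda>i j. smult (fps_nth f i * fps_nth g j) ((pderiv ^^ (i + j)) p)"
  have "op_series f pderiv (op_series g pderiv p) = (\<Sum>i\<le>?N. \<Sum>j\<le>?N. ?h i j)"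
    by (subst op_series_atMost[OF lowers_degree_pderiv degree_op_series_pderiv])
       (simp add: op_series_def higher_pderiv_sum higher_pderiv_smult smult_sum_right funpow_add)
  also have "\<dots> = (\<Sum>(i, j)\<in>{..?N} \<times> {..?N}. ?h i j)"
    by (simp add: sum.cartesian_product)
  also have "\<dots> = (\<Sum>(i, j)\<in>{(i, j). i + j \<le> ?N}. ?h i j)"
    by (rule sum.mono_neutral_right)
       (auto intro!: funpow_lowers_degree lowers_degree_pderiv)
  also have "\<dots> = (\<Sum>k\<le>?N. \<Sum>i\<le>k. ?h i (k - i))"
    by (rule sum.triangle_reindex_eq)
  also have "\<dots> = op_series (f * g) pderiv p"
    by (simp add: op_series_def fps_mult_nth smult_sum atLeast0AtMost)
  finally show ?thesis by simp
qed

lemma op_series_1: "op_series 1 T p = p"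
proof -
  have "op_series 1 T p = (\<Sum>n\<le>degree p. if n = 0 then p else 0)"
    unfolding op_series_def by (rule sum.cong) auto
  then show ?thesis by simp
qed

lemma op_series_X:
  fixes p :: "'a::field_char_0 poly"
  shows "op_series fps_X pderiv p = pderiv p"
proof -
  have "op_series fps_X pderiv p =
      (\<Sum>n\<le>Suc (degree p). smult (fps_nth fps_X n) ((pderiv ^^ n) p))"
    by (rule op_series_atMost[OF lowers_degree_pderiv]) simp
  also have "\<dots> = (\<Sum>n\<le>Suc (degree p). if n = 1 then pderiv p else 0)"
    by (rule sum.cong) auto
  finally show ?thesis by simp
qed

lemma ex_pderiv_eq:
  fixes q :: "'a::field_char_0 poly"
  shows "\<exists>p. pderiv p = q \<and> poly p 0 = 0"
proof -
  define r where "r = (\<Sum>i\<le>degree q. monom (coeff q i / of_nat (Suc i)) (Suc i))"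
  have "pderiv r = (\<Sum>i\<le>degree q. monom (coeff q i) i)"
    unfolding r_def using higher_pderiv_sum[of 1 "\<lambda>i. monom (coeff q i / of_nat (Suc i)) (Suc i)"]
    by (simp add: pderiv_monom del: of_nat_Suc)
  then have "pderiv r = q" by (simp add: poly_as_sum_of_monoms)
  moreover have "poly r 0 = 0"
    by (simp add: r_def poly_sum poly_monom)
  ultimately show ?thesis by blast
qed

lemma ex1_op_series_eq:
  fixes \<phi> :: "'a::field_char_0 fps"
  assumes "delta_series \<phi>"
  shows "\<exists>!p. op_series \<phi> pderiv p = q \<and> poly p 0 = 0"
proof -
  define u where "u = fps_shift 1 \<phi>"
  have \<phi>: "\<phi> = u * fps_X"
    using assms unfolding u_def delta_series_def
    by (intro fps_ext) auto
  have u: "inverse u * u = 1"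
    using assms by (intro inverse_mult_eq_1) (simp add: u_def delta_series_def)
  have D: "op_series (inverse u) pderiv (op_series \<phi> pderiv p) = pderiv p" for p
  proof -
    have "inverse u * \<phi> = fps_X" by (simp add: \<phi> u flip: mult.assoc)
    then show ?thesis by (simp add: op_series_X flip: op_series_mult)
  qed
  obtain p where p: "pderiv p = op_series (inverse u) pderiv q" "poly p 0 = 0"
    using ex_pderiv_eq by blast
  have "op_series \<phi> pderiv p = op_series u pderiv (op_series fps_X pderiv p)"
    unfolding \<phi> by (rule op_series_mult)
  also have "\<dots> = op_series (u * inverse u) pderiv q"
    by (simp only: op_series_X p op_series_mult)
  also have "\<dots> = q" using u by (simp add: mult.commute op_series_1)
  finally have ex: "op_series \<phi> pderiv p = q" .
  have "r = p" if "op_series \<phi> pderiv r = q" "poly r 0 = 0" for r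
  proof -
    have "pderiv (r - p) = 0" using D[of r] D[of p] that ex by (simp add: pderiv_diff)
    then obtain c where "r - p = [:c:]" by (metis pderiv_eq_0_iff degree_eq_zeroE)
    moreover have "poly (r - p) 0 = 0" using that p by simp
    ultimately show ?thesis by simp
  qed
  with ex p show ?thesis by blast
qed

lemma ex1_poweroids:
  fixes \<phi> :: "'a::field_char_0 fps"
  assumes "delta_series \<phi>"
  shows "\<exists>!p. is_poweroids (op_series \<phi> pderiv) p"
proof -
  define S where "S = (\<lambda>q. THE p. op_series \<phi> pderiv p = q \<and> poly p 0 = 0)"
  have S: "op_series \<phi> pderiv (S q) = q \<and> poly (S q) 0 = 0" for q
    unfolding S_def by (rule theI'[OF ex1_op_series_eq[OF assms]])
  define p where "p = rec_nat 1 (\<lambda>n q. S (smult (of_nat (Suc n)) q))"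
  have p_0: "p 0 = 1" and p_Suc: "p (Suc n) = S (smult (of_nat (Suc n)) (p n))" for n
    by (simp_all add: p_def)
  have "is_poweroids (op_series \<phi> pderiv) p"
    unfolding is_poweroids_def
  proof (intro conjI allI impI)
    fix n :: nat assume "1 \<le> n"
    then obtain m where "n = Suc m" by (cases n) auto
    then show "op_series \<phi> pderiv (p n) = smult (of_nat n) (p (n - 1))" "poly (p n) 0 = 0"
      using S by (simp_all only: p_Suc diff_Suc_1)
  qed (rule p_0)
  moreover have "q = p" if q: "is_poweroids (op_series \<phi> pderiv) q" for q
  proof
    fix n show "q n = p n"
    proof (induction n)
      case 0
      then show ?case using q p_0 by (simp add: is_poweroids_def)
    next
      case (Suc n)
      have "op_series \<phi> pderiv (q (Suc n)) = smult (of_nat (Suc n)) (p n) \<and> poly (q (Suc n)) 0 = 0"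
        using q Suc unfolding is_poweroids_def
        by (metis diff_Suc_1 le_add1 plus_1_eq_Suc)
      moreover have "op_series \<phi> pderiv (p (Suc n)) = smult (of_nat (Suc n)) (p n) \<and> poly (p (Suc n)) 0 = 0"
        unfolding p_Suc by (rule S)
      ultimately show ?case using ex1_op_series_eq[OF assms] by blast
    qed
  qed
  ultimately show ?thesis by blast
qed

lemma is_poweroids_poweroid:
  fixes \<phi> :: "'a::field_char_0 fps"
  assumes "delta_series \<phi>"
  shows "is_poweroids (op_series \<phi> pderiv) (poweroid (op_series \<phi> pderiv))"
  unfolding poweroid_def by (rule theI'[OF ex1_poweroids[OF assms]])

end

(* Both sides equal r! times the coefficient of t^r in the composition of f with the inverse of
   \<phi>: an operator g(\<theta>) sends the r-th poweroid of \<theta> to a polynomial with value r! g_r at 0, and this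
   applies to \<theta> = \<phi>(D) as well as to D itself, whose poweroids are the ordinary powers. *)

theory Submission
  imports Defs
begin

lemma op_series_pderiv_smult:
  fixes p :: "'a::field_char_0 poly"
  shows "op_series f pderiv (smult c p) = smult c (op_series f pderiv p)"
  by (subst (1 2) op_series_atMost[OF lowers_degree_pderiv, where N = "degree p"])
     (simp_all add: degree_smult_le higher_pderiv_smult smult_sum_right mult.commute)

lemma funpow_op_series_pderiv:
  fixes p :: "'a::field_char_0 poly"
  shows "(op_series f pderiv ^^ n) p = op_series (f ^ n) pderiv p"
  by (induction n) (simp_all add: op_series_1 op_series_mult)

text \<open>Since \<open>\<phi>\<close> has no constant term, \<open>\<phi> ^ n\<close> has order at
  least \<open>n\<close>. So the coefficients of \<open>f oo \<phi>\<close> up to index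
  \<open>degree p\<close> involve only \<open>n \<le> degree p\<close>: both sides are the same
  finite double sum, summed in different orders.\<close>

lemma op_series_compose:
  fixes \<phi> :: "'a::field_char_0 fps"
  assumes "fps_nth \<phi> 0 = 0"
  shows "op_series f (op_series \<phi> pderiv) p = op_series (f oo \<phi>) pderiv p"
proof -
  let ?N = "degree p"
  have coeff: "fps_nth (f oo \<phi>) k = (\<Sum>n\<le>?N. fps_nth f n * fps_nth (\<phi> ^ n) k)" if "k \<le> ?N" for k
    unfolding fps_compose_nth
    by (rule sum.mono_neutral_left) (use that startsby_zero_power_prefix[OF assms] in auto)
  have "op_series f (op_series \<phi> pderiv) p =
      (\<Sum>n\<le>?N. \<Sum>k\<le>?N. smult (fps_nth f n * fps_nth (\<phi> ^ n) k) ((pderiv ^^ k) p))"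
    by (simp add: op_series_def[of f] funpow_op_series_pderiv op_series_def[of "\<phi> ^ _"] smult_sum_right)
  also have "\<dots> = (\<Sum>k\<le>?N. \<Sum>n\<le>?N. smult (fps_nth f n * fps_nth (\<phi> ^ n) k) ((pderiv ^^ k) p))"
    by (rule sum.swap)
  also have "\<dots> = op_series (f oo \<phi>) pderiv p"
    by (simp add: op_series_def coeff smult_sum)
  finally show ?thesis .
qed

text \<open>Each application of \<open>T\<close> lowers the index by one and brings the old index
  out as a factor. For \<open>n < r\<close> this leaves a multiple of some \<open>p m\<close> with
  \<open>m > 0\<close>, which vanishes at 0; for \<open>n = r\<close> it leaves the constant
  \<open>r!\<close>, which any further application kills.\<close>

lemma poly_0_funpow_poweroids:
  fixes p :: "nat \<Rightarrow> 'a::{comm_semiring_1, semiring_char_0} poly"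
  assumes "is_poweroids T p" and "lowers_degree T"
    and smult: "\<And>c q. T (smult c q) = smult c (T q)"
  shows "poly ((T ^^ n) (p r)) 0 = (if n = r then fact r else 0)"
proof (induction n arbitrary: r)
  case 0
  then show ?case using assms(1) by (cases r) (auto simp: is_poweroids_def)
next
  case (Suc n)
  have pow: "(T ^^ n) (smult c q) = smult c ((T ^^ n) q)" for n c q
    by (induction n) (simp_all add: smult)
  show ?case
  proof (cases r)
    case 0
    then have "(T ^^ Suc n) (p r) = 0"
      using assms(1) by (intro funpow_lowers_degree[OF assms(2)]) (simp add: is_poweroids_def)
    then show ?thesis using 0 by simp
  next
    case (Suc m)
    then have "T (p r) = smult (of_nat r) (p m)"
      using assms(1) by (simp add: is_poweroids_def)
    \<comment> \<open>The innermost \<open>T\<close> is split off, since it is the one that acts on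
      \<open>p r\<close>; hence the induction keeps \<open>r\<close> arbitrary.\<close>
    then have "(T ^^ Suc n) (p r) = smult (of_nat r) ((T ^^ n) (p m))"
      by (simp add: funpow_Suc_right pow del: funpow.simps)
    then show ?thesis using Suc Suc.IH[of m] by simp
  qed
qed

lemma poly_0_op_series_poweroids:
  fixes p :: "nat \<Rightarrow> 'a::{comm_semiring_1, semiring_char_0} poly"
  assumes "is_poweroids T p" and "lowers_degree T"
    and "\<And>c q. T (smult c q) = smult c (T q)"
  shows "poly (op_series g T (p r)) 0 = fps_nth g r * fact r"
proof -
  \<comment> \<open>Adding \<open>r\<close> to the summation bound puts the index \<open>r\<close>
    in range without computing \<open>degree (p r)\<close>.\<close>
  have "poly (op_series g T (p r)) 0 =
      (\<Sum>n\<le>degree (p r) + r. fps_nth g n * poly ((T ^^ n) (p r)) 0)"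
    by (subst op_series_atMost[OF assms(2), where N = "degree (p r) + r"]) (simp_all add: poly_sum)
  also have "\<dots> = fps_nth g r * fact r"
    by (simp add: poly_0_funpow_poweroids[OF assms] if_distrib cong: if_cong)
  finally show ?thesis .
qed

lemma is_poweroids_pderiv_monom:
  "is_poweroids pderiv (monom 1 :: nat \<Rightarrow> 'a::field_char_0 poly)"
  by (auto simp: is_poweroids_def pderiv_monom smult_monom poly_monom power_0_left)

theorem mainTheorem2:
  fixes \<phi> f :: "'a::field_char_0 fps"
    and \<theta> \<eta> :: "'a poly \<Rightarrow> 'a poly"
    and r :: nat
  assumes "delta_series \<phi>"
    and "\<theta> = op_series \<phi> pderiv"
    and "\<eta> = op_series (fps_inv \<phi>) pderiv"
  shows "poly (op_series f pderiv (poweroid \<theta> r)) 0 = poly (op_series f \<eta> (monom 1 r)) 0"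
proof -
  \<comment> \<open>Chosen so that \<open>g(\<theta>) = f(D)\<close> and
    \<open>g(D) = f(\<eta>)\<close>: both sides then read off the same coefficient of
    \<open>g\<close>.\<close>
  define g where "g = f oo fps_inv \<phi>"
  have \<phi>: "fps_nth \<phi> 0 = 0" "fps_nth \<phi> 1 \<noteq> 0"
    using assms(1) by (simp_all add: delta_series_def)
  have inv: "fps_nth (fps_inv \<phi>) 0 = 0"
    by (simp add: fps_inv_def)
  have f: "g oo \<phi> = f"
    unfolding g_def by (simp add: fps_inv[OF \<phi>] inv \<phi>(1) flip: fps_compose_assoc)
  have "poly (op_series f pderiv (poweroid \<theta> r)) 0 = poly (op_series g \<theta> (poweroid \<theta> r)) 0"
    unfolding assms(2) by (simp add: op_series_compose[OF \<phi>(1)] f)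
  also have "\<dots> = fps_nth g r * fact r"
    unfolding assms(2)
    by (rule poly_0_op_series_poweroids[OF is_poweroids_poweroid[OF assms(1)]
          lowers_degree_op_series[OF \<phi>(1)] op_series_pderiv_smult])
  \<comment> \<open>The same coefficient formula, used backwards for \<open>D\<close> and its
    poweroids, the monomials.\<close>
  also have "\<dots> = poly (op_series g pderiv (monom 1 r)) 0"
    by (rule poly_0_op_series_poweroids[OF is_poweroids_pderiv_monom lowers_degree_pderiv
          pderiv_smult, symmetric])
  also have "\<dots> = poly (op_series f \<eta> (monom 1 r)) 0"
    unfolding assms(3) g_def by (simp add: op_series_compose[OF inv])
  finally show ?thesis .
qed

end
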